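(* For every integer $q$ with $2\le q<\infty$, $$\mathcal{R}_+(\mathcal{T}_q\times\mathcal{T}_q)\subsetneq\mathcal{R}_+(\mathcal{T}_q).$$
   Context: $\mathbb{N}=\{0,1,2,\dots\}$. For an integer $q\ge 2$, $\mathcal{T}_q$ is the $(q+1)$-homogeneous tree (every vertex has degree $q+1$). A graph is identified with its vertex set, and $d$ is the edge-path distance. The product $X_1\times X_2$ of connected graphs has as vertices the pairs $(x_1,x_2)$, $x_i\in X_i$, with an edge between $(x_1,x_2)$ and $(y_1,y_2)$ if and only if $d_1(x_1,y_1)+d_2(x_2,y_2)=1$, where $d_i$ is the edge-path distance on $X_i$ (so the edge-path distance on the product is $d_1(x_1,y_1)+d_2(x_2,y_2)$). A function $\psi:X\times X\to\mathbb{C}$ is positive definite if $\sum_{i,j=1}^n\psi(x_i,x_j)\overline{z_i}z_j\ge 0$ for all finite families $x_1,\dots,x_n\in X$ and $z_1,\dots,z_n\in\mathbb{C}$. For a connected graph $X$, $\mathcal{R}_+(X)$ is the set of functions $\varphi:\mathbb{N}\to\mathbb{C}$ such that $(x,y)\mapsto\varphi(d(x,y))$ is positive definite on $X$. *)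

theory Defs
  imports "HOL-Library.Complex_Order"
begin

text \<open>
  A graph is given by its adjacency relation; all elements of the type \<^typ>\<open>'a\<close> are vertices.
\<close>

definition simple_graph :: "'a rel \<Rightarrow> bool" where
  "simple_graph E \<longleftrightarrow> sym E \<and> irrefl E"

definition connected_graph :: "'a rel \<Rightarrow> bool" where
  "connected_graph E \<longleftrightarrow> simple_graph E \<and> (\<forall>x y. (x, y) \<in> E\<^sup>*)"

text \<open>The edge-path distance; only meaningful for pairs of vertices joined by a path.\<close>

definition graph_dist :: "'a rel \<Rightarrow> 'a \<Rightarrow> 'a \<Rightarrow> nat" where
  "graph_dist E x y = (LEAST n. (x, y) \<in> E ^^ n)"

definition graph_prod :: "'a rel \<Rightarrow> 'b rel \<Rightarrow> ('a \<times> 'b) rel" where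
  "graph_prod E F = {((x1, x2), (y1, y2)). graph_dist E x1 y1 + graph_dist F x2 y2 = 1}"

definition is_cycle :: "'a rel \<Rightarrow> 'a list \<Rightarrow> bool" where
  "is_cycle E xs \<longleftrightarrow> length xs \<ge> 3 \<and> distinct xs \<and>
     (\<forall>i < length xs. (xs ! i, xs ! (Suc i mod length xs)) \<in> E)"

definition is_tree :: "'a rel \<Rightarrow> bool" where
  "is_tree E \<longleftrightarrow> connected_graph E \<and> (\<nexists>xs. is_cycle E xs)"

text \<open>
  The homogeneous tree of degree \<open>q + 1\<close>, characterised up to isomorphism. As \<open>card\<close> is \<open>0\<close> on
  infinite sets, the degree condition includes local finiteness.
\<close>

definition homogeneous_tree :: "nat \<Rightarrow> 'a rel \<Rightarrow> bool" where
  "homogeneous_tree q E \<longleftrightarrow> is_tree E \<and> (\<forall>x. card (E `` {x}) = q + 1)"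

text \<open>
  The order on \<^typ>\<open>complex\<close> is the one of \<^theory>\<open>HOL-Library.Complex_Order\<close>: \<open>0 \<le> w\<close> says
  that \<open>w\<close> is real and nonnegative.
\<close>

definition positive_definite :: "('a \<Rightarrow> 'a \<Rightarrow> complex) \<Rightarrow> bool" where
  "positive_definite \<psi> \<longleftrightarrow>
     (\<forall>(n::nat) (x :: nat \<Rightarrow> 'a) (z :: nat \<Rightarrow> complex).
        0 \<le> (\<Sum>i<n. \<Sum>j<n. \<psi> (x i) (x j) * cnj (z i) * z j))"

definition R_plus :: "'a rel \<Rightarrow> (nat \<Rightarrow> complex) set" where
  "R_plus E = {\<phi>. positive_definite (\<lambda>x y. \<phi> (graph_dist E x y))}"

text \<open>
  Homogeneous trees exist on a countable vertex set: root the tree at \<open>0\<close>, with children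
  \<open>1, \<dots>, q + 1\<close>, and let \<open>n > 0\<close> have the children \<open>q * n + 2, \<dots>, q * n + q + 1\<close>.
\<close>

lemma homogeneous_tree_exists:
  assumes "q \<ge> 2"
  shows "\<exists>E :: nat rel. homogeneous_tree q E"
proof -
  define p where "p n = (n - 2) div q" for n :: nat
  define E where "E = {(m, n). (0 < m \<and> n = p m) \<or> (0 < n \<and> m = p n)}"
  have p_less: "p n < n" if "0 < n" for n
  proof (cases "n < 2")
    case True
    with that show ?thesis using assms by (simp add: p_def)
  next
    case False
    have "p n \<le> n - 2" by (simp add: p_def)
    with False show ?thesis by linarith
  qed
  have simple: "simple_graph E"
    unfolding simple_graph_def E_def sym_def irrefl_def by (auto dest: p_less)
  have to_root: "(n, 0) \<in> E\<^sup>*" for n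
  proof (induction n rule: less_induct)
    case (less n)
    show ?case
    proof (cases "n = 0")
      case False
      then have "(n, p n) \<in> E" by (simp add: E_def)
      with less p_less False show ?thesis by (meson converse_rtrancl_into_rtrancl gr0I)
    qed simp
  qed
  have "sym (E\<^sup>*)" using simple by (simp add: simple_graph_def sym_rtrancl)
  then have conn: "connected_graph E"
    using simple to_root unfolding connected_graph_def by (meson rtrancl_trans symD)
  have acyclic: "\<not> is_cycle E xs" for xs
  proof
    assume cyc: "is_cycle E xs"
    define l where "l = length xs"
    have l3: "l \<ge> 3" and dist: "distinct xs" and ed: "\<And>i. i < l \<Longrightarrow> (xs ! i, xs ! (Suc i mod l)) \<in> E"
      using cyc by (auto simp: is_cycle_def l_def)
    have "Max (set xs) \<in> set xs" using l3 by (intro Max_in) (auto simp: l_def)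
    then obtain k where k: "k < l" "xs ! k = Max (set xs)" by (metis in_set_conv_nth l_def)
    have top: "xs ! i \<le> xs ! k" if "i < l" for i
      using that k by (simp add: l_def)
    have down: "n = p m" if "(m, n) \<in> E \<or> (n, m) \<in> E" "n \<le> m" for m n
      using that p_less[of n] by (auto simp: E_def)
    define s where "s = (if Suc k = l then 0 else Suc k)"
    define t where "t = (if k = 0 then l - 1 else k - 1)"
    have s: "s < l" "Suc k mod l = s" using k(1) l3 by (auto simp: s_def)
    have t: "t < l" "Suc t mod l = k" using k(1) l3 by (auto simp: t_def)
    have "s \<noteq> t" using k(1) l3 by (auto simp: s_def t_def split: if_splits)
    moreover have "xs ! s = p (xs ! k)" using down ed[OF k(1)] s top by auto
    moreover have "xs ! t = p (xs ! k)" using down ed[OF t(1)] t top by auto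
    ultimately show False using dist s t by (metis l_def nth_eq_iff_index_eq)
  qed
  have p_iff: "0 < m \<and> p m = n \<longleftrightarrow> (if n = 0 then m \<in> {1..q+1} else m \<in> {q*n+2..q*n+q+1})" for m n
  proof -
    have "p m = n \<longleftrightarrow> q * n \<le> m - 2 \<and> m - 2 < q * n + q"
      using div_nat_eqI[of q n "m - 2"] div_times_less_eq_dividend[of "m - 2" q]
        dividend_less_times_div[of q "m - 2"] assms
      unfolding p_def by (fastforce simp: algebra_simps)
    moreover have "q * n \<ge> 2" if "n \<noteq> 0" using that assms by (cases n) auto
    ultimately show ?thesis using assms by auto
  qed
  have deg: "card (E `` {n}) = q + 1" for n
  proof (cases "n = 0")
    case True
    have "E `` {n} = {m. 0 < m \<and> p m = n}" using True unfolding E_def by blast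
    also have "\<dots> = {1..q+1}" unfolding p_iff using True by auto
    finally show ?thesis by simp
  next
    case False
    have "E `` {n} = insert (p n) {m. 0 < m \<and> p m = n}" using False unfolding E_def by blast
    also have "{m. 0 < m \<and> p m = n} = {q*n+2..q*n+q+1}" unfolding p_iff using False by auto
    finally have "E `` {n} = insert (p n) {q*n+2..q*n+q+1}" .
    moreover have "n \<le> q * n" using assms by simp
    with p_less[of n] False have "p n < q * n + 2" by linarith
    then have "p n \<notin> {q*n+2..q*n+q+1}" by simp
    ultimately show ?thesis by simp
  qed
  show ?thesis
    using conn acyclic deg unfolding homogeneous_tree_def is_tree_def by blast
qed

end

theory Submission
  imports Defs
begin

text \<open>
  Let \<open>A\<close> be the adjacency operator of the tree \<open>T\<close> of degree \<open>q + 1\<close>. The kernel of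
  \<open>(3q + 1 - A\<^sup>2)\<^sup>2\<close> is radial, being a polynomial in \<open>A\<close>, and positive definite, being
  a square. Its value is \<open>5q\<^sup>2 + q\<close> at distance \<open>0\<close> and \<open>-(3q + 1)\<close> at distance \<open>2\<close>. A sphere
  of radius \<open>1\<close> in \<open>T \<times> T\<close> consists of \<open>2q + 2\<close> points at mutual distance \<open>2\<close>, so positive
  definiteness on the product would force \<open>5q\<^sup>2 + q \<ge> (2q + 1)(3q + 1)\<close>, which is false.
  The inclusion holds because \<open>T\<close> embeds isometrically in \<open>T \<times> T\<close>.
\<close>

subsection \<open>Distance in connected graphs and their products\<close>

context
  fixes E :: "'a rel"
  assumes conn: "connected_graph E"
begin

lemma graph_edge_sym: "(x, y) \<in> E \<Longrightarrow> (y, x) \<in> E"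
  using conn by (auto simp: connected_graph_def simple_graph_def dest: symD)

lemma graph_edge_neq: "(x, y) \<in> E \<Longrightarrow> x \<noteq> y"
  using conn by (auto simp: connected_graph_def simple_graph_def irrefl_def)

lemma graph_dist_relpow: "(x, y) \<in> E ^^ graph_dist E x y"
proof -
  have "(x, y) \<in> E\<^sup>*" using conn by (simp add: connected_graph_def)
  then have "\<exists>n. (x, y) \<in> E ^^ n" by (rule rtrancl_imp_relpow)
  then show ?thesis unfolding graph_dist_def by (rule LeastI_ex)
qed

lemma graph_dist_le: "(x, y) \<in> E ^^ n \<Longrightarrow> graph_dist E x y \<le> n"
  unfolding graph_dist_def by (rule Least_le)

lemma graph_dist_eq_0_iff [simp]: "graph_dist E x y = 0 \<longleftrightarrow> x = y"
  using graph_dist_relpow[of x y] graph_dist_le[of x y 0] by auto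

lemma graph_dist_eq_1_iff: "graph_dist E x y = 1 \<longleftrightarrow> (x, y) \<in> E"
proof
  assume "graph_dist E x y = 1"
  then show "(x, y) \<in> E" using graph_dist_relpow[of x y] by simp
next
  assume e: "(x, y) \<in> E"
  then have "graph_dist E x y \<le> 1" by (intro graph_dist_le) simp
  moreover have "graph_dist E x y \<noteq> 0" using graph_edge_neq[OF e] by simp
  ultimately show "graph_dist E x y = 1" by linarith
qed

lemma graph_dist_triangle: "graph_dist E x z \<le> graph_dist E x y + graph_dist E y z"
  using graph_dist_relpow[of x y] graph_dist_relpow[of y z]
  by (intro graph_dist_le) (auto simp: relpow_add)

lemma graph_dist_commute: "graph_dist E x y = graph_dist E y x"
proof -
  have le: "graph_dist E b a \<le> graph_dist E a b" for a b
  proof (rule graph_dist_le)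
    have "(v, u) \<in> E ^^ n" if "(u, v) \<in> E ^^ n" for u v n
      using that
      by (induction n arbitrary: v)
        (auto simp del: relpow.simps(2) elim!: relpow_Suc_E intro: relpow_Suc_I2 graph_edge_sym)
    then show "(b, a) \<in> E ^^ graph_dist E a b" using graph_dist_relpow by blast
  qed
  show ?thesis using le[of x y] le[of y x] by simp
qed

lemma graph_dist_step: "(x, w) \<in> E \<Longrightarrow> graph_dist E x y \<le> Suc (graph_dist E w y)"
  using graph_dist_triangle[of x y w] graph_dist_eq_1_iff[of x w] by simp

lemma graph_dist_geodesic:
  assumes "x \<noteq> y"
  obtains w where "(x, w) \<in> E" "graph_dist E x y = Suc (graph_dist E w y)"
proof -
  obtain n where n: "graph_dist E x y = Suc n" using assms not0_implies_Suc by fastforce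
  then obtain w where w: "(x, w) \<in> E" "(w, y) \<in> E ^^ n"
    using relpow_Suc_D2[of x y n E] graph_dist_relpow[of x y] by auto
  have "graph_dist E x y = Suc (graph_dist E w y)"
    using graph_dist_step[OF w(1), of y] graph_dist_le[OF w(2)] n by simp
  with w(1) show ?thesis by (rule that)
qed

end

text \<open>Walking first in one coordinate and then in the other attains the sum. No walk is
  shorter: a product edge has total displacement 1, and the triangle inequality holds in each
  factor.\<close>

lemma graph_dist_prod:
  assumes E: "connected_graph E" and F: "connected_graph F"
  shows "graph_dist (graph_prod E F) (x1, x2) (y1, y2) = graph_dist E x1 y1 + graph_dist F x2 y2"
proof -
  have fst_path: "((a, c), (b, c)) \<in> graph_prod E F ^^ n" if "(a, b) \<in> E ^^ n" for a b c n
    using that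
  proof (induction n arbitrary: b)
    case (Suc n)
    then obtain w where "(a, w) \<in> E ^^ n" "(w, b) \<in> E" by auto
    moreover from this have "((w, c), (b, c)) \<in> graph_prod E F"
      using graph_dist_eq_1_iff[OF E, of w b] graph_dist_eq_0_iff[OF F, of c c]
      by (simp add: graph_prod_def)
    ultimately show ?case using Suc.IH by auto
  qed simp
  have snd_path: "((c, a), (c, b)) \<in> graph_prod E F ^^ n" if "(a, b) \<in> F ^^ n" for a b c n
    using that
  proof (induction n arbitrary: b)
    case (Suc n)
    then obtain w where "(a, w) \<in> F ^^ n" "(w, b) \<in> F" by auto
    moreover from this have "((c, w), (c, b)) \<in> graph_prod E F"
      using graph_dist_eq_1_iff[OF F, of w b] graph_dist_eq_0_iff[OF E, of c c]
      by (simp add: graph_prod_def)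
    ultimately show ?case using Suc.IH by auto
  qed simp
  have lower: "graph_dist E a1 (fst b) + graph_dist F a2 (snd b) \<le> n"
    if "((a1, a2), b) \<in> graph_prod E F ^^ n" for a1 a2 b n
    using that
  proof (induction n arbitrary: b)
    case 0
    then show ?case using graph_dist_eq_0_iff[OF E] graph_dist_eq_0_iff[OF F] by auto
  next
    case (Suc n)
    then obtain w1 w2 where w: "((a1, a2), (w1, w2)) \<in> graph_prod E F ^^ n"
      "((w1, w2), b) \<in> graph_prod E F" by auto
    have "graph_dist E w1 (fst b) + graph_dist F w2 (snd b) = 1"
      using w(2) by (auto simp: graph_prod_def)
    with Suc.IH[OF w(1)] show ?case
      using graph_dist_triangle[OF E, of a1 "fst b" w1] graph_dist_triangle[OF F, of a2 "snd b" w2]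
      by simp
  qed
  have path: "((x1, x2), (y1, y2)) \<in> graph_prod E F ^^ (graph_dist E x1 y1 + graph_dist F x2 y2)"
    unfolding relpow_add
    using fst_path[OF graph_dist_relpow[OF E]] snd_path[OF graph_dist_relpow[OF F]]
    by (rule relcompI)
  show ?thesis
    unfolding graph_dist_def[of "graph_prod E F"]
    using path lower[of x1 x2 "(y1, y2)"] by (intro Least_equality) simp_all
qed

subsection \<open>Neighbours in a tree\<close>

lemma rtrancl_distinct_path:
  assumes "(a, b) \<in> R\<^sup>*"
  obtains xs where "xs \<noteq> []" "hd xs = a" "last xs = b" "distinct xs" "successively (\<lambda>u v. (u, v) \<in> R) xs"
proof -
  have "\<exists>xs. xs \<noteq> [] \<and> hd xs = a \<and> last xs = b \<and> distinct xs \<and> successively (\<lambda>u v. (u, v) \<in> R) xs"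
    using assms
  proof (induction rule: rtrancl_induct)
    case base
    show ?case by (rule exI[of _ "[a]"]) simp
  next
    case (step b c)
    then obtain xs where xs: "xs \<noteq> []" "hd xs = a" "last xs = b" "distinct xs"
      "successively (\<lambda>u v. (u, v) \<in> R) xs" by blast
    show ?case
    proof (cases "c \<in> set xs")
      case True
      \<comment> \<open>Loop erasure: the path already visits \<open>c\<close>, so it is cut off
        right after that visit.\<close>
      then obtain ys zs where "xs = (ys @ [c]) @ zs" using split_list by fastforce
      with xs show ?thesis
        by (intro exI[of _ "ys @ [c]"]) (auto simp: successively_append_iff hd_append split: if_splits)
    next
      case False
      with xs step.hyps show ?thesis
        by (intro exI[of _ "xs @ [c]"]) (auto simp: successively_append_iff)
    qed
  qed
  then show ?thesis using that by blast
qed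

context
  fixes E :: "'a rel"
  assumes tree: "is_tree E"
begin

lemma tree_connected: "connected_graph E"
  using tree by (simp add: is_tree_def)

text \<open>A path from \<open>w1\<close> to \<open>w2\<close> avoiding \<open>x\<close>, once freed
  of repetitions, would close up through \<open>x\<close> to a cycle.\<close>

lemma tree_neighbours_separated:
  assumes w: "(x, w1) \<in> E" "(x, w2) \<in> E"
    and path: "(w1, w2) \<in> {(a, b) \<in> E. a \<noteq> x \<and> b \<noteq> x}\<^sup>*"
  shows "w1 = w2"
proof (rule ccontr)
  assume neq: "w1 \<noteq> w2"
  define R where "R = {(a, b) \<in> E. a \<noteq> x \<and> b \<noteq> x}"
  obtain xs where xs: "xs \<noteq> []" "hd xs = w1" "last xs = w2" "distinct xs"
    "successively (\<lambda>u v. (u, v) \<in> R) xs"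
    by (rule rtrancl_distinct_path[OF path[folded R_def]])
  have len: "length xs \<ge> 2"
    using xs(1-3) neq by (cases xs) (auto simp: Suc_le_eq split: if_splits)
  have step: "(xs ! i, xs ! Suc i) \<in> R" if "Suc i < length xs" for i
    using xs(5) that by (simp add: successively_conv_nth)
  \<comment> \<open>Since \<open>xs\<close> has at least two entries, each of them is an endpoint of
    an \<open>R\<close>-step, and such steps avoid \<open>x\<close>.\<close>
  have "x \<notin> set xs"
  proof
    assume "x \<in> set xs"
    then obtain i where i: "i < length xs" "xs ! i = x" by (metis in_set_conv_nth)
    show False
    proof (cases i)
      case 0
      then show False using step[of 0] len i by (auto simp: R_def)
    next
      case (Suc j)
      then show False using step[of j] i by (auto simp: R_def)
    qed
  qed
  moreover have "((x # xs) ! i, (x # xs) ! (Suc i mod length (x # xs))) \<in> E"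
    if i: "i < length (x # xs)" for i
  proof -
    \<comment> \<open>The edges of the cycle: from \<open>x\<close> to \<open>w1\<close>, along
      \<open>xs\<close> with indices shifted by one, and from \<open>w2\<close> back to
      \<open>x\<close>.\<close>
    consider "i = 0" | j where "i = Suc j" "Suc j < length xs" | "i = length xs"
      using i by (cases i) (auto simp: less_Suc_eq)
    then show ?thesis
    proof cases
      case 1
      then show ?thesis using w(1) xs len by (simp add: hd_conv_nth)
    next
      case 2
      then show ?thesis using step[of j] by (simp add: R_def)
    next
      case 3
      then show ?thesis
        using graph_edge_sym[OF tree_connected w(2)] xs len by (simp add: last_conv_nth nth_Cons')
    qed
  qed
  ultimately have "is_cycle E (x # xs)"
    using len xs(4) by (simp add: is_cycle_def)
  then show False using tree by (auto simp: is_tree_def)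
qed

text \<open>Along a geodesic from \<open>w\<close> to \<open>y\<close>, every vertex after
  \<open>w\<close> is strictly closer to \<open>y\<close> than \<open>x\<close> is, hence differs
  from \<open>x\<close>.\<close>

lemma tree_geodesic_avoids:
  assumes "w \<noteq> x" "graph_dist E w y \<le> graph_dist E x y"
  shows "(w, y) \<in> {(a, b) \<in> E. a \<noteq> x \<and> b \<noteq> x}\<^sup>*"
  using assms
proof (induction "graph_dist E w y" arbitrary: w)
  case 0
  then show ?case using graph_dist_eq_0_iff[OF tree_connected, of w y] by simp
next
  case (Suc n)
  then have "w \<noteq> y" using graph_dist_eq_0_iff[OF tree_connected, of w y] by auto
  then obtain v where v: "(w, v) \<in> E" "graph_dist E w y = Suc (graph_dist E v y)"
    using graph_dist_geodesic[OF tree_connected] by metis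
  moreover from this have "v \<noteq> x" using Suc.prems(2) by auto
  ultimately have "v \<noteq> x" "(v, y) \<in> {(a, b) \<in> E. a \<noteq> x \<and> b \<noteq> x}\<^sup>*"
    using Suc.hyps Suc.prems(2) by simp_all
  with v(1) Suc.prems(1) show ?case by (auto intro: converse_rtrancl_into_rtrancl)
qed

text \<open>Both neighbours reach \<open>y\<close> without passing \<open>x\<close>, hence reach
  each other that way. The bounds are non-strict so that neighbours at the same distance from
  \<open>y\<close> as \<open>x\<close> are covered too.\<close>

lemma tree_closer_neighbour_unique:
  assumes "(x, w1) \<in> E" "graph_dist E w1 y \<le> graph_dist E x y"
    and "(x, w2) \<in> E" "graph_dist E w2 y \<le> graph_dist E x y"
  shows "w1 = w2"
proof (rule tree_neighbours_separated[OF assms(1,3)])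
  define R where "R = {(a, b) \<in> E. a \<noteq> x \<and> b \<noteq> x}"
  have "w1 \<noteq> x" "w2 \<noteq> x" using assms graph_edge_neq[OF tree_connected] by blast+
  then have "(w1, y) \<in> R\<^sup>*" "(w2, y) \<in> R\<^sup>*"
    using assms tree_geodesic_avoids by (auto simp: R_def)
  moreover have "sym (R\<^sup>*)"
    by (intro sym_rtrancl) (auto simp: R_def sym_def intro: graph_edge_sym[OF tree_connected])
  ultimately show "(w1, w2) \<in> R\<^sup>*" by (meson rtrancl_trans symD)
qed

text \<open>\<open>p\<close> opens a geodesic to \<open>y\<close>. Any other neighbour not farther
  from \<open>y\<close> than \<open>x\<close> would equal \<open>p\<close> by uniqueness, and one
  edge changes the distance by at most 1.\<close>

lemma tree_neighbours_dist:
  assumes "x \<noteq> y"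
  obtains p where "(x, p) \<in> E" "Suc (graph_dist E p y) = graph_dist E x y"
    "\<And>w. (x, w) \<in> E \<Longrightarrow> w \<noteq> p \<Longrightarrow> graph_dist E w y = Suc (graph_dist E x y)"
proof -
  obtain p where p: "(x, p) \<in> E" "graph_dist E x y = Suc (graph_dist E p y)"
    using graph_dist_geodesic[OF tree_connected assms] by metis
  have far: "graph_dist E w y = Suc (graph_dist E x y)" if "(x, w) \<in> E" "w \<noteq> p" for w
  proof -
    have "graph_dist E w y > graph_dist E x y"
      using tree_closer_neighbour_unique[OF that(1) _ p(1), of y] p(2) that(2) by fastforce
    moreover have "graph_dist E w y \<le> Suc (graph_dist E x y)"
      using that graph_edge_sym graph_dist_step tree_connected by metis
    ultimately show ?thesis by simp
  qed
  show ?thesis using that p far by simp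
qed

text \<open>The neighbour of \<open>v\<close> closer to \<open>b\<close> is \<open>b\<close> itself,
  so \<open>a\<close> lies one step beyond \<open>v\<close>.\<close>

lemma tree_siblings_dist:
  assumes "(v, a) \<in> E" "(v, b) \<in> E" "a \<noteq> b"
  shows "graph_dist E a b = 2"
proof -
  have "v \<noteq> b" using assms graph_edge_neq[OF tree_connected] by blast
  then obtain p where p: "Suc (graph_dist E p b) = graph_dist E v b"
    "\<And>w. (v, w) \<in> E \<Longrightarrow> w \<noteq> p \<Longrightarrow> graph_dist E w b = Suc (graph_dist E v b)"
    using tree_neighbours_dist by metis
  moreover have vb: "graph_dist E v b = 1"
    using assms graph_dist_eq_1_iff[OF tree_connected] by blast
  ultimately have "p = b" using graph_dist_eq_0_iff[OF tree_connected, of p b] by simp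
  then show ?thesis using p(2)[of a] vb assms by simp
qed

end

subsection \<open>A positive definite radial function on the tree\<close>

text \<open>The action of the adjacency operator on functions of the distance to a fixed vertex.\<close>

definition radial_adj :: "nat \<Rightarrow> (nat \<Rightarrow> real) \<Rightarrow> nat \<Rightarrow> real" where
  "radial_adj q h n = (if n = 0 then (real q + 1) * h 1 else h (n - 1) + real q * h (n + 1))"

text \<open>The kernels of \<open>3q + 1 - A\<^sup>2\<close> and of its square, as functions of the distance.\<close>

definition root_fun :: "nat \<Rightarrow> nat \<Rightarrow> real" where
  "root_fun q n = (if n = 0 then 2 * real q else if n = 2 then - 1 else 0)"

definition square_fun :: "nat \<Rightarrow> nat \<Rightarrow> real" where
  "square_fun q n = (3 * real q + 1) * root_fun q n - radial_adj q (radial_adj q (root_fun q)) n"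

text \<open>\<open>radial_adj q (root_fun q)\<close> is \<open>q\<close> at 1 and \<open>-1\<close>
  at 3, so applying \<open>radial_adj q\<close> again gives \<open>q * (q + 1)\<close> at 0 and
  \<open>q - q = 0\<close> at 2. On the constant: for the kernel of (c - A^2)^2, the value at 0 plus
  2q + 1 times the value at 2 is c^2 - 2(3q + 2)c + 2(2q + 1)^2. This is least at c = 3q + 2; the
  nearby c = 3q + 1 keeps it negative and produces the cancellation at 2.\<close>

lemma square_fun_values:
  "square_fun q 0 = 5 * (real q)\<^sup>2 + real q"
  "square_fun q 2 = - (3 * real q + 1)"
  by (simp_all add: square_fun_def radial_adj_def root_fun_def power2_eq_square algebra_simps)

section \<open>Positive definiteness: Gram kernels and a test on finite sets\<close>

text \<open>The quadratic form becomes the sum over \<open>w\<close> of the squared moduli of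
  \<open>s w\<close>. Letting \<open>W\<close> be any finite superset of one support allows a common
  index set for all \<open>x i\<close>.\<close>

lemma positive_definite_Gram:
  fixes k :: "'a \<Rightarrow> 'b \<Rightarrow> real"
  assumes fin: "\<And>x. finite {w. k x w \<noteq> 0}"
    and gram: "\<And>x y W. finite W \<Longrightarrow> {w. k x w \<noteq> 0} \<subseteq> W \<Longrightarrow> (\<Sum>w\<in>W. k x w * k y w) = \<psi> x y"
  shows "positive_definite (\<lambda>x y. complex_of_real (\<psi> x y))"
  unfolding positive_definite_def
proof (intro allI)
  fix n :: nat and x :: "nat \<Rightarrow> 'a" and z :: "nat \<Rightarrow> complex"
  define W where "W = (\<Union>i<n. {w. k (x i) w \<noteq> 0})"
  define s where "s w = (\<Sum>j<n. of_real (k (x j) w) * z j)" for w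
  have W: "finite W" using fin by (simp add: W_def)
  have "(\<Sum>i<n. \<Sum>j<n. of_real (\<psi> (x i) (x j)) * cnj (z i) * z j)
      = (\<Sum>i<n. \<Sum>j<n. \<Sum>w\<in>W. of_real (k (x i) w) * cnj (z i) * (of_real (k (x j) w) * z j))"
  proof (intro sum.cong refl)
    fix i j assume "i \<in> {..<n}"
    then have "{w. k (x i) w \<noteq> 0} \<subseteq> W" by (auto simp: W_def)
    then have "\<psi> (x i) (x j) = (\<Sum>w\<in>W. k (x i) w * k (x j) w)"
      using gram[OF W, of "x i" "x j"] by simp
    then show "of_real (\<psi> (x i) (x j)) * cnj (z i) * z j
        = (\<Sum>w\<in>W. of_real (k (x i) w) * cnj (z i) * (of_real (k (x j) w) * z j))"
      by (simp add: sum_distrib_right sum_distrib_left algebra_simps)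
  qed
  also have "\<dots> = (\<Sum>i<n. \<Sum>w\<in>W. \<Sum>j<n. of_real (k (x i) w) * cnj (z i) * (of_real (k (x j) w) * z j))"
    by (rule sum.cong[OF refl], rule sum.swap)
  also have "\<dots> = (\<Sum>w\<in>W. \<Sum>i<n. \<Sum>j<n. of_real (k (x i) w) * cnj (z i) * (of_real (k (x j) w) * z j))"
    by (rule sum.swap)
  also have "\<dots> = (\<Sum>w\<in>W. cnj (s w) * s w)"
    by (simp add: s_def sum_product)
  also have "\<dots> \<ge> 0"
    by (intro sum_nonneg) (simp add: less_eq_complex_def)
  finally show "0 \<le> (\<Sum>i<n. \<Sum>j<n. of_real (\<psi> (x i) (x j)) * cnj (z i) * z j)" .
qed

text \<open>Take all coefficients equal to 1 along an enumeration of \<open>S\<close>.\<close>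

lemma positive_definite_sum_nonneg:
  assumes "positive_definite \<psi>" "finite S"
  shows "0 \<le> (\<Sum>x\<in>S. \<Sum>y\<in>S. \<psi> x y)"
proof -
  obtain h where h: "bij_betw h {0..<card S} S"
    using ex_bij_betw_nat_finite[OF assms(2)] by blast
  have "0 \<le> (\<Sum>i<card S. \<Sum>j<card S. \<psi> (h i) (h j) * cnj 1 * 1)"
    using assms(1)[unfolded positive_definite_def, rule_format,
        where n = "card S" and x = h and z = "\<lambda>_. 1"] .
  also have "\<dots> = (\<Sum>x\<in>S. \<Sum>y\<in>S. \<psi> x y)"
    using h by (simp add: sum.reindex_bij_betw lessThan_atLeast0
        sum.reindex_bij_betw[where g = "\<lambda>x. \<Sum>y\<in>S. \<psi> x y"])
  finally show ?thesis .
qed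

section \<open>Adjacency sums on the homogeneous tree and the witness function\<close>

context
  fixes E :: "'a rel" and q :: nat
  assumes hom: "homogeneous_tree q E"
begin

lemma hom_tree: "is_tree E"
  using hom by (simp add: homogeneous_tree_def)

lemma hom_tree_conn: "connected_graph E"
  using hom_tree by (rule tree_connected)

lemma hom_tree_degree: "card (E `` {x}) = q + 1"
  using hom by (simp add: homogeneous_tree_def)

lemma hom_tree_finite: "finite (E `` {x})"
  \<comment> \<open>\<open>card\<close> is 0 on infinite sets, while the degree \<open>q + 1\<close>
    is not.\<close>
  using hom_tree_degree[of x] card.infinite by fastforce

text \<open>This justifies \<open>radial_adj\<close>: for \<open>x \<noteq> y\<close>, one neighbour
  of \<open>x\<close> is closer to \<open>y\<close> and the other \<open>q\<close> are farther; for
  \<open>x = y\<close>, all \<open>q + 1\<close> are at distance 1.\<close>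

lemma sum_neighbours_radial:
  "(\<Sum>w\<in>E `` {x}. h (graph_dist E w y)) = radial_adj q h (graph_dist E x y)"
proof (cases "x = y")
  case True
  have "graph_dist E w y = 1" if "w \<in> E `` {x}" for w
    using that True graph_dist_eq_1_iff[OF hom_tree_conn] graph_edge_sym[OF hom_tree_conn] by auto
  moreover have "graph_dist E x y = 0" using True graph_dist_eq_0_iff[OF hom_tree_conn, of x y] by simp
  ultimately show ?thesis using hom_tree_degree[of x] by (simp add: radial_adj_def)
next
  case False
  then obtain p where p: "(x, p) \<in> E" "Suc (graph_dist E p y) = graph_dist E x y"
    "\<And>w. (x, w) \<in> E \<Longrightarrow> w \<noteq> p \<Longrightarrow> graph_dist E w y = Suc (graph_dist E x y)"
    using tree_neighbours_dist[OF hom_tree False] by metis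
  have "(\<Sum>w\<in>E `` {x}. h (graph_dist E w y))
      = h (graph_dist E p y) + (\<Sum>w\<in>E `` {x} - {p}. h (graph_dist E w y))"
    using p(1) hom_tree_finite by (intro sum.remove) auto
  also have "(\<Sum>w\<in>E `` {x} - {p}. h (graph_dist E w y)) = real q * h (Suc (graph_dist E x y))"
    using p hom_tree_degree[of x] hom_tree_finite[of x] by simp
  finally show ?thesis using p(2)[symmetric] by (simp add: radial_adj_def)
qed

text \<open>Identifies \<open>root_fun\<close> as the kernel of 3q + 1 - A^2 acting on an arbitrary
  \<open>g\<close>; the double neighbour sum is A^2.\<close>

lemma root_fun_convolution:
  assumes W: "finite W" "{w. root_fun q (graph_dist E x w) \<noteq> 0} \<subseteq> W"
  shows "(\<Sum>w\<in>W. root_fun q (graph_dist E x w) * g w)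
    = (3 * real q + 1) * g x - (\<Sum>u\<in>E `` {x}. \<Sum>w\<in>E `` {u}. g w)"
proof -
  \<comment> \<open>A finite set containing \<open>W\<close>, \<open>x\<close> and all endpoints of
    two-step walks from \<open>x\<close>, so that every sum below can run over it;
    \<open>one\<close> is the kernel of A.\<close>
  define V where "V = insert x (W \<union> (\<Union>u\<in>E `` {x}. E `` {u}))"
  define one :: "nat \<Rightarrow> real" where "one n = (if n = 1 then 1 else 0)" for n
  have V: "finite V" using W(1) hom_tree_finite by (simp add: V_def)
  \<comment> \<open>A^2 has kernel \<open>q + 1\<close> at distance 0 and 1 at distance 2, which
    explains the value \<open>2 * q\<close> of \<open>root_fun\<close> at 0.\<close>
  have root: "root_fun q n = (if n = 0 then 3 * real q + 1 else 0) - radial_adj q one n" for n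
    by (auto simp: root_fun_def radial_adj_def one_def)
  have "(\<Sum>u\<in>E `` {x}. \<Sum>w\<in>E `` {u}. g w)
      = (\<Sum>u\<in>E `` {x}. \<Sum>w\<in>V. one (graph_dist E u w) * g w)"
  proof (rule sum.cong[OF refl])
    fix u assume "u \<in> E `` {x}"
    then show "sum g (E `` {u}) = (\<Sum>w\<in>V. one (graph_dist E u w) * g w)"
      using V graph_dist_eq_1_iff[OF hom_tree_conn]
      by (intro sum.mono_neutral_cong_left) (auto simp: V_def one_def)
  qed
  also have "\<dots> = (\<Sum>w\<in>V. (\<Sum>u\<in>E `` {x}. one (graph_dist E u w)) * g w)"
    by (subst sum.swap) (simp add: sum_distrib_right)
  also have "\<dots> = (\<Sum>w\<in>V. radial_adj q one (graph_dist E x w) * g w)"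
    by (simp add: sum_neighbours_radial)
  also have "\<dots> = (\<Sum>w\<in>V. (if w = x then (3 * real q + 1) * g w else 0))
      - (\<Sum>w\<in>V. root_fun q (graph_dist E x w) * g w)"
    unfolding sum_subtractf[symmetric]
    using graph_dist_eq_0_iff[OF hom_tree_conn]
    by (intro sum.cong refl) (auto simp: root algebra_simps)
  also have "(\<Sum>w\<in>V. (if w = x then (3 * real q + 1) * g w else 0)) = (3 * real q + 1) * g x"
    using V by (simp add: V_def)
  also have "(\<Sum>w\<in>V. root_fun q (graph_dist E x w) * g w)
      = (\<Sum>w\<in>W. root_fun q (graph_dist E x w) * g w)"
    using V W by (intro sum.mono_neutral_right) (auto simp: V_def)
  finally show ?thesis by simp
qed

lemma root_fun_finite_support: "finite {w. root_fun q (graph_dist E x w) \<noteq> 0}"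
proof (rule finite_subset)
  show "{w. root_fun q (graph_dist E x w) \<noteq> 0} \<subseteq> insert x (\<Union>u\<in>E `` {x}. E `` {u})"
  proof
    fix w assume "w \<in> {w. root_fun q (graph_dist E x w) \<noteq> 0}"
    then consider "graph_dist E x w = 0" | "graph_dist E x w = 2"
      by (auto simp: root_fun_def split: if_splits)
    then show "w \<in> insert x (\<Union>u\<in>E `` {x}. E `` {u})"
    proof cases
      case 1
      then show ?thesis using graph_dist_eq_0_iff[OF hom_tree_conn] by simp
    next
      case 2
      then have "(x, w) \<in> E ^^ 2" using graph_dist_relpow[OF hom_tree_conn] by metis
      then show ?thesis by (auto simp: numeral_2_eq_2)
    qed
  qed
qed (simp add: hom_tree_finite)

text \<open>The Gram vectors are the rows of the \<open>root_fun\<close> kernel. Since this kernel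
  is symmetric, their inner products are the kernel of the squared operator, computed by one
  convolution and two neighbour sums.\<close>

lemma square_fun_R_plus: "(\<lambda>n. complex_of_real (square_fun q n)) \<in> R_plus E"
proof -
  have "positive_definite (\<lambda>x y. complex_of_real (square_fun q (graph_dist E x y)))"
  proof (rule positive_definite_Gram[where k = "\<lambda>x w. root_fun q (graph_dist E x w)"])
    fix x y :: 'a and W :: "'a set"
    assume W: "finite W" "{w. root_fun q (graph_dist E x w) \<noteq> 0} \<subseteq> W"
    have "(\<Sum>w\<in>W. root_fun q (graph_dist E x w) * root_fun q (graph_dist E y w))
        = (\<Sum>w\<in>W. root_fun q (graph_dist E x w) * root_fun q (graph_dist E w y))"
      by (simp add: graph_dist_commute[OF hom_tree_conn, of y])
    also have "\<dots> = square_fun q (graph_dist E x y)"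
      by (simp add: root_fun_convolution[OF W] sum_neighbours_radial square_fun_def)
    finally show "(\<Sum>w\<in>W. root_fun q (graph_dist E x w) * root_fun q (graph_dist E y w))
        = square_fun q (graph_dist E x y)" .
  qed (rule root_fun_finite_support)
  then show ?thesis by (simp add: R_plus_def)
qed

section \<open>Comparison of the product with the tree\<close>

text \<open>Sum the kernel over all pairs from a unit sphere: each of its \<open>2 * q + 2\<close>
  rows has one diagonal entry and \<open>2 * q + 1\<close> entries at distance 2.\<close>

lemma R_plus_square_ineq:
  assumes "\<phi> \<in> R_plus (graph_prod E E)"
  shows "0 \<le> \<phi> 0 + of_nat (2 * q + 1) * \<phi> 2"
proof -
  fix v :: 'a
  \<comment> \<open>The unit sphere around \<open>(v, v)\<close>: one coordinate moves to a
    neighbour of \<open>v\<close>, the other stays.\<close>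
  define S where "S = (\<lambda>a. (a, v)) ` (E `` {v}) \<union> Pair v ` (E `` {v})"
  have v: "v \<notin> E `` {v}" using graph_edge_neq[OF hom_tree_conn] by blast
  have fin: "finite S" using hom_tree_finite by (simp add: S_def)
  have "card S = card ((\<lambda>a. (a, v)) ` (E `` {v})) + card (Pair v ` (E `` {v}))"
    unfolding S_def using v hom_tree_finite by (intro card_Un_disjoint) auto
  also have "\<dots> = 2 * q + 2"
    using hom_tree_degree[of v] by (simp add: card_image inj_on_def)
  finally have card: "card S = 2 * q + 2" .
  have [simp]: "graph_dist E a a = 0" for a
    using graph_dist_eq_0_iff[OF hom_tree_conn, of a a] by simp
  have near: "graph_dist E v a = 1" "graph_dist E a v = 1" if "(v, a) \<in> E" for a
    using that graph_dist_eq_1_iff[OF hom_tree_conn] graph_edge_sym[OF hom_tree_conn] by blast+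
  have siblings: "a = b" if "(v, a) \<in> E" "(v, b) \<in> E" "graph_dist E a b \<noteq> 2" for a b
    using that tree_siblings_dist[OF hom_tree] by blast
  \<comment> \<open>Points that moved in different coordinates are at distance 1 + 1; points that
    moved in the same coordinate are siblings.\<close>
  have dist: "graph_dist (graph_prod E E) s t = 2" if st: "s \<in> S" "t \<in> S" "s \<noteq> t" for s t
    using st by (auto simp: S_def near graph_dist_prod[OF hom_tree_conn hom_tree_conn] intro: siblings)
  have self: "graph_dist (graph_prod E E) s s = 0" for s
    by (cases s) (simp add: graph_dist_prod[OF hom_tree_conn hom_tree_conn])
  have row: "(\<Sum>t\<in>S. \<phi> (graph_dist (graph_prod E E) s t)) = \<phi> 0 + of_nat (2 * q + 1) * \<phi> 2"
    if s: "s \<in> S" for s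
  proof -
    have "(\<Sum>t\<in>S - {s}. \<phi> (graph_dist (graph_prod E E) s t)) = (\<Sum>t\<in>S - {s}. \<phi> 2)"
      using dist[OF s] by (intro sum.cong refl) (metis DiffE singletonI)
    also have "\<dots> = of_nat (2 * q + 1) * \<phi> 2" using s fin card by simp
    finally have "(\<Sum>t\<in>S - {s}. \<phi> (graph_dist (graph_prod E E) s t)) = of_nat (2 * q + 1) * \<phi> 2" .
    then show ?thesis using s fin by (simp add: sum.remove self)
  qed
  have "0 \<le> (\<Sum>s\<in>S. \<Sum>t\<in>S. \<phi> (graph_dist (graph_prod E E) s t))"
    using assms fin by (intro positive_definite_sum_nonneg) (simp_all add: R_plus_def)
  also have "\<dots> = of_nat (2 * q + 2) * (\<phi> 0 + of_nat (2 * q + 1) * \<phi> 2)"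
    by (simp add: row card)
  \<comment> \<open>Nonnegativity in \<open>complex\<close> means real part at least 0 and imaginary
    part 0; the positive factor \<open>2 * q + 2\<close> cancels from both.\<close>
  finally show ?thesis
    by (auto simp: less_eq_complex_def zero_le_mult_iff)
qed

end

text \<open>For fixed \<open>v\<close>, the slice map sending \<open>x\<close> to
  \<open>(x, v)\<close> preserves distances, so a test family in the first factor is also one in the
  product.\<close>

lemma R_plus_prod_subset:
  assumes E: "connected_graph E" and F: "connected_graph F"
  shows "R_plus (graph_prod E F) \<subseteq> R_plus E"
proof
  fix \<phi> assume "\<phi> \<in> R_plus (graph_prod E F)"
  then have pd: "positive_definite (\<lambda>s t. \<phi> (graph_dist (graph_prod E F) s t))"
    by (simp add: R_plus_def)
  fix v
  have "graph_dist (graph_prod E F) (x, v) (y, v) = graph_dist E x y" for x y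
    using graph_dist_eq_0_iff[OF F, of v v] by (simp add: graph_dist_prod[OF E F])
  moreover have "0 \<le> (\<Sum>i<n. \<Sum>j<n.
      \<phi> (graph_dist (graph_prod E F) (x i, v) (x j, v)) * cnj (z i) * z j)"
    for n :: nat and x :: "nat \<Rightarrow> 'a" and z :: "nat \<Rightarrow> complex"
    using pd[unfolded positive_definite_def, rule_format,
        where n = n and x = "\<lambda>i. (x i, v)" and z = z] .
  ultimately show "\<phi> \<in> R_plus E" by (simp add: R_plus_def positive_definite_def)
qed

theorem corollary1p7:
  fixes q :: nat and T :: "'a rel"
  assumes "2 \<le> q"
    and "homogeneous_tree q T"
  shows "R_plus (graph_prod T T) \<subset> R_plus T"
proof -
  have conn: "connected_graph T" using assms(2) by (rule hom_tree_conn)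
  have "(\<lambda>n. complex_of_real (square_fun q n)) \<notin> R_plus (graph_prod T T)"
  proof
    assume "(\<lambda>n. complex_of_real (square_fun q n)) \<in> R_plus (graph_prod T T)"
    \<comment> \<open>All values are real, so the complex inequality reduces to its real
      part.\<close>
    from R_plus_square_ineq[OF assms(2) this] have "0 \<le> square_fun q 0 + (2 * real q + 1) * square_fun q 2"
      by (simp add: less_eq_complex_def add.commute)
    also have "\<dots> = - ((real q)\<^sup>2 + 4 * real q + 1)"
      unfolding square_fun_values by (simp add: power2_eq_square algebra_simps)
    also have "\<dots> < 0" using zero_le_power2[of "real q"] by linarith
    finally show False by simp
  qed
  then show ?thesis
    using R_plus_prod_subset[OF conn conn] square_fun_R_plus[OF assms(2)] by blast
qed

end
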